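(* Let $a, b \in \mathbb{Z}$ and $n \in \mathbb{N}$, and let $i=\sqrt{-1}$. \begin{enumerate} \item If $n \not\equiv 5 \pmod 7$ and $21 \nmid a$, then $P_n^\sigma(ai + b) \neq 0$. \item If $n \equiv 5 \pmod 7$ and at least one of the following holds: (i) $3 \nmid a$; (ii) $a \not\equiv 0, 1, -1 \pmod 7$; (iii) $7 \nmid a$ and $7 \nmid b$; then $P_n^\sigma(ai + b) \neq 0$. \end{enumerate}
   Context: Let $\sigma(n) = \sum_{d \mid n} d$ be the sum-of-divisors function. The D'Arcais polynomials $P_n^\sigma(X) \in \mathbb{Q}[X]$ are defined by the formal power series identity \[\sum_{n=0}^\infty P_n^\sigma(X) q^n = \prod_{n=1}^\infty (1-q^n)^{-X} = \exp\Big(X \sum_{n=1}^\infty \sigma(n)\frac{q^n}{n}\Big).\] *)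

theory Defs
  imports "HOL-Computational_Algebra.Computational_Algebra"
    "HOL-Number_Theory.Cong"
begin

definition divisor_sigma :: "nat \<Rightarrow> nat" where
  "divisor_sigma n = (\<Sum>d | d dvd n. d)"

text \<open>
  The series \<open>X * (\<Sum>n\<ge>1. \<sigma>(n) / n * q^n)\<close> in \<open>\<rat>[X][[q]]\<close>; its constant term is \<open>0\<close>
  because division by \<open>0\<close> yields \<open>0\<close>.
\<close>

definition darcais_exponent :: "rat poly fps" where
  "darcais_exponent = Abs_fps (\<lambda>n. monom (of_nat (divisor_sigma n) / of_nat n) 1)"

text \<open>
  The exponential series is written out because \<open>fps_exp\<close> needs a field of coefficients,
  which \<open>\<rat>[X]\<close> is not.
\<close>

definition darcais_gen :: "rat poly fps" where
  "darcais_gen = fps_compose (Abs_fps (\<lambda>k. [:1 / fact k:])) darcais_exponent"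

definition darcais :: "nat \<Rightarrow> rat poly" where
  "darcais n = fps_nth darcais_gen n"

end

theory Submission
  imports Defs
begin

text \<open>
  The polynomials \<open>A\<^sub>n = n! P\<^sub>n\<close> have integer coefficients and satisfy
  \<open>A\<^sub>n = X \<Sum>\<^bsub>j<n\<^esub> \<sigma>(n - j) (n - 1)!/j! A\<^sub>j\<close>. In this recurrence for \<open>A\<^bsub>p+r\<^esub>\<close> the terms with
  \<open>j < p\<close> vanish modulo \<open>p\<close>, which gives \<open>A\<^bsub>p+r\<^esub> \<equiv> A\<^sub>p A\<^sub>r\<close> and hence
  \<open>A\<^bsub>pm+r\<^esub> \<equiv> A\<^sub>p\<^sup>m A\<^sub>r\<close> modulo \<open>p\<close>. So if \<open>p\<close> is prime and \<open>A\<^bsub>pm+r\<^esub>\<close> vanishes at a Gaussian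
  integer \<open>z\<close>, then \<open>p\<close> divides the norm of \<open>A\<^sub>p(z)\<close> or of \<open>A\<^sub>r(z)\<close>. For \<open>p = 3\<close> and \<open>p = 7\<close>
  this depends only on \<open>z\<close> modulo \<open>p\<close>, and finitely many residues are checked. The
  exceptional class \<open>n \<equiv> 5\<close> modulo \<open>7\<close> comes from the factor \<open>X\<^sup>2 + 1\<close> of \<open>A\<^sub>5\<close> modulo \<open>7\<close>.
\<close>

lemma smult_sum_right: "smult c (\<Sum>i\<in>I. f i) = (\<Sum>i\<in>I. smult c (f i))"
  by (rule poly_eqI) (simp add: coeff_sum sum_distrib_left)

lemma map_poly_of_int_sum:
  "map_poly of_int (\<Sum>j\<in>I. f j) = (\<Sum>j\<in>I. map_poly of_int (f j) :: 'a :: comm_ring_1 poly)"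
  by (rule poly_eqI) (simp add: coeff_map_poly coeff_sum)

lemma map_poly_of_int_add:
  "map_poly of_int (f + g) = (map_poly of_int f + map_poly of_int g :: 'a :: comm_ring_1 poly)"
  by (rule poly_eqI) (simp add: coeff_map_poly)

lemma map_poly_of_int_mult:
  "map_poly of_int (f * g) = (map_poly of_int f * map_poly of_int g :: 'a :: comm_ring_1 poly)"
  by (rule poly_eqI) (simp add: coeff_map_poly coeff_mult)

section \<open>The recurrence for the D'Arcais polynomials\<close>

lemma fps_deriv_exp_series:
  "fps_deriv (Abs_fps (\<lambda>k. [:1 / fact k:])) = (Abs_fps (\<lambda>k. [:1 / fact k:]) :: rat poly fps)"
proof (rule fps_ext)
  fix n
  have "(of_nat n + 1) / ((of_nat n + 1) * fact n) = (1 / fact n :: rat)"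
    by (subst nonzero_divide_mult_cancel_left) simp_all
  then show "fps_deriv (Abs_fps (\<lambda>k. [:1 / fact k:])) $ n
      = (Abs_fps (\<lambda>k. [:1 / fact k:]) :: rat poly fps) $ n"
    by (simp add: of_nat_poly add.commute)
qed

lemma darcais_0: "darcais 0 = 1"
  by (simp add: darcais_def darcais_gen_def darcais_exponent_def one_pCons)

text \<open>Logarithmic differentiation: \<open>G = exp E\<close> gives \<open>G' = G * E'\<close>,
  and the coefficients of \<open>q^(n - 1)\<close> are compared. Differentiating \<open>E\<close>
  cancels the denominators of its coefficients.\<close>

lemma darcais_recurrence:
  assumes "n > 0"
  shows "smult (of_nat n) (darcais n) =
    [:0, 1:] * (\<Sum>j<n. smult (of_nat (divisor_sigma (n - j))) (darcais j))"
proof -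
  obtain m where n: "n = Suc m" using assms gr0_conv_Suc by auto
  \<comment> \<open>The chain rule for composition requires that \<open>darcais_exponent\<close>
    have constant term \<open>0\<close>.\<close>
  have "fps_deriv darcais_gen = darcais_gen * fps_deriv darcais_exponent"
    unfolding darcais_gen_def
    by (subst fps_compose_deriv) (simp_all add: darcais_exponent_def fps_deriv_exp_series)
  then have "fps_deriv darcais_gen $ m = (darcais_gen * fps_deriv darcais_exponent) $ m"
    by simp
  then have "of_nat n * darcais n = (\<Sum>j=0..m. darcais j *
      (of_nat (n - j) * monom (of_nat (divisor_sigma (n - j)) / of_nat (n - j)) 1))"
    by (simp add: fps_mult_nth darcais_def n darcais_exponent_def Suc_diff_le del: of_nat_Suc)
  also have "\<dots> = (\<Sum>j=0..m. [:0, 1:] * smult (of_nat (divisor_sigma (n - j))) (darcais j))"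
  proof (rule sum.cong)
    fix j assume "j \<in> {0..m}"
    then have "of_nat (n - j) \<noteq> (0 :: rat)" using n by simp
    then have "of_nat (n - j) * monom (of_nat (divisor_sigma (n - j)) / of_nat (n - j)) 1
        = monom (of_nat (divisor_sigma (n - j)) :: rat) 1"
      by (simp add: of_nat_poly smult_monom)
    then show "darcais j * (of_nat (n - j) * monom (of_nat (divisor_sigma (n - j)) / of_nat (n - j)) 1)
      = [:0, 1:] * smult (of_nat (divisor_sigma (n - j))) (darcais j)"
      by (simp add: monom_Suc monom_0 mult.commute)
  qed simp
  also have "{0..m} = {..<n}" using n by auto
  finally show ?thesis by (simp add: of_nat_poly sum_distrib_left)
qed

section \<open>Clearing denominators\<close>

text \<open>
  The polynomial \<open>n! P\<^sub>n\<close>; the product over \<open>{Suc j..<n}\<close> is the integer \<open>(n - 1)! / j!\<close>.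
\<close>

function int_darcais :: "nat \<Rightarrow> int poly" where
  "int_darcais n = (if n = 0 then 1 else
     [:0, 1:] * (\<Sum>j<n. smult (int (divisor_sigma (n - j) * \<Prod>{Suc j..<n})) (int_darcais j)))"
  by pat_completeness auto
termination by (relation "measure id") auto

declare int_darcais.simps [simp del]

lemma fact_mult_prod_Suc_interval:
  "j < n \<Longrightarrow> fact j * \<Prod>{Suc j..<n} = (fact (n - 1) :: nat)"
proof (induction n)
  case (Suc n)
  show ?case
  proof (cases "j = n")
    case False
    then have "{Suc j..<Suc n} = insert n {Suc j..<n}" using Suc.prems by auto
    moreover have "n * fact (n - 1) = (fact n :: nat)"
      using False Suc.prems by (simp add: fact_reduce)
    moreover have "fact j * \<Prod>{Suc j..<n} = (fact (n - 1) :: nat)"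
      using Suc False by simp
    ultimately show ?thesis by (simp add: mult.left_commute)
  qed simp
qed simp

text \<open>The recurrence for \<open>darcais n\<close> is multiplied by
  \<open>fact (n - 1)\<close>; writing this factor as \<open>fact j\<close> times an integer turns
  each \<open>darcais j\<close> into \<open>int_darcais j\<close>.\<close>

lemma int_darcais_eq: "map_poly of_int (int_darcais n) = smult (fact n) (darcais n)"
proof (induction n rule: less_induct)
  case (less n)
  show ?case
  proof (cases "n = 0")
    case True
    then show ?thesis by (simp add: int_darcais.simps darcais_0)
  next
    case False
    define c where "c j = divisor_sigma (n - j) * \<Prod>{Suc j..<n}" for j
    have "(map_poly of_int (int_darcais n) :: rat poly)
        = [:0, 1:] * (\<Sum>j<n. smult (of_nat (c j)) (map_poly of_int (int_darcais j)))"
      using False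
      by (subst int_darcais.simps)
        (simp add: c_def map_poly_pCons map_poly_of_int_sum map_poly_smult)
    also have "\<dots> = [:0, 1:] * (\<Sum>j<n. smult (fact (n - 1))
        (smult (of_nat (divisor_sigma (n - j))) (darcais j)))"
    proof (intro arg_cong2 [where f = "(*)"] sum.cong refl)
      fix j assume j: "j \<in> {..<n}"
      then have "of_nat (c j) * fact j = (fact (n - 1) * of_nat (divisor_sigma (n - j)) :: rat)"
        using arg_cong [OF fact_mult_prod_Suc_interval, of j n "of_nat :: nat \<Rightarrow> rat"]
        by (simp add: c_def mult_ac)
      then show "smult (of_nat (c j)) (map_poly of_int (int_darcais j))
        = smult (fact (n - 1)) (smult (of_nat (divisor_sigma (n - j))) (darcais j))"
        using j less by simp
    qed
    also have "\<dots> = smult (fact (n - 1)) (smult (of_nat n) (darcais n))"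
      using False
      by (subst darcais_recurrence) (simp_all add: smult_sum_right sum_distrib_left)
    also have "\<dots> = smult (fact n) (darcais n)"
      using False by (simp add: fact_reduce mult.commute)
    finally show ?thesis .
  qed
qed

section \<open>Congruences between the integral polynomials\<close>

text \<open>Divisibility by the constant polynomial encodes congruence of all coefficients. The sum
  for index \<open>p + r\<close> is split at \<open>p\<close>; its upper part is the sum for
  \<open>r\<close>, shifted by \<open>p\<close>.\<close>

lemma int_darcais_add:
  "[:int p:] dvd int_darcais (p + r) - int_darcais p * int_darcais r"
proof (induction r rule: less_induct)
  case (less r)
  show ?case
  proof (cases "r = 0")
    case True
    then show ?thesis by (simp add: int_darcais.simps [of 0])
  next
    case False
    define c where "c n j = int (divisor_sigma (n - j) * \<Prod>{Suc j..<n})" for n j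
    have rec: "int_darcais n = [:0, 1:] * (\<Sum>j<n. smult (c n j) (int_darcais j))" if "n > 0" for n
      using that by (subst int_darcais.simps) (simp add: c_def)
    have "{..<p + r} = {..<p} \<union> (+) p ` {..<r}"
      by (simp add: lessThan_atLeast0 ivl_disj_un add.commute)
    then have "(\<Sum>j<p + r. smult (c (p + r) j) (int_darcais j))
      = (\<Sum>j<p. smult (c (p + r) j) (int_darcais j))
      + (\<Sum>s\<in>(+) p ` {..<r}. smult (c (p + r) s) (int_darcais s))"
      by (simp only:) (rule sum.union_disjoint, auto)
    also have "(\<Sum>s\<in>(+) p ` {..<r}. smult (c (p + r) s) (int_darcais s))
      = (\<Sum>s<r. smult (c (p + r) (p + s)) (int_darcais (p + s)))"
      by (subst sum.reindex) auto
    finally have sum_split: "int_darcais (p + r) - int_darcais p * int_darcais r = [:0, 1:] *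
       ((\<Sum>j<p. smult (c (p + r) j) (int_darcais j)) +
        (\<Sum>s<r. smult (c (p + r) (p + s)) (int_darcais (p + s))
               - smult (c r s) (int_darcais p * int_darcais s)))"
      using False
      by (subst rec [of "p + r"], simp, subst rec [of r], simp)
        (simp add: sum_subtractf sum_distrib_left algebra_simps)
    have const: "[:int p:] dvd [:k:] * f" if "int p dvd k" for k f
      using that by (intro dvd_mult2) simp
    have low: "[:int p:] dvd smult (c (p + r) j) (int_darcais j)" if "j < p" for j
    proof -
      \<comment> \<open>As \<open>j < p\<close> and \<open>r > 0\<close>, the number
        \<open>p\<close> is itself a factor of this product.\<close>
      have "p dvd \<Prod>{Suc j..<p + r}"
        using that False by (intro dvd_prodI [of _ p "\<lambda>i. i"]) auto
      then have "int p dvd c (p + r) j" unfolding c_def by (simp flip: of_nat_mult)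
      then show ?thesis using const [of "c (p + r) j"] by simp
    qed
    have high: "[:int p:] dvd smult (c (p + r) (p + s)) (int_darcais (p + s))
        - smult (c r s) (int_darcais p * int_darcais s)" if "s < r" for s
    proof -
      have "\<Prod>{Suc (p + s)..<p + r} = (\<Prod>i\<in>{Suc s..<r}. p + i)"
        using prod.shift_bounds_nat_ivl [of "\<lambda>i. i" "Suc s" p r] by (simp add: add_ac)
      then have "[\<Prod>{Suc (p + s)..<p + r} = \<Prod>{Suc s..<r}] (mod p)"
        by (simp only:) (rule cong_prod, simp add: cong_def)
      then have "[divisor_sigma (r - s) * \<Prod>{Suc (p + s)..<p + r}
          = divisor_sigma (r - s) * \<Prod>{Suc s..<r}] (mod p)"
        by (rule cong_scalar_left)
      then have "int p dvd c (p + r) (p + s) - c r s"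
        unfolding c_def by (simp add: cong_iff_dvd_diff flip: cong_int_iff)
      \<comment> \<open>The difference is split so that the first summand is divisible by the
        congruence of the weights and the second by the induction hypothesis for
        \<open>s\<close>.\<close>
      then have "[:int p:] dvd [:c (p + r) (p + s) - c r s:] * int_darcais (p + s)
          + [:c r s:] * (int_darcais (p + s) - int_darcais p * int_darcais s)"
        by (intro dvd_add const dvd_mult less that)
      then show ?thesis by (simp add: smult_diff_left smult_diff_right)
    qed
    show ?thesis
      unfolding sum_split by (intro dvd_mult dvd_add dvd_sum low high) auto
  qed
qed

lemma int_darcais_mult_add:
  "[:int p:] dvd int_darcais (p * m + r) - int_darcais p ^ m * int_darcais r"
proof (induction m)
  case (Suc m)
  have "int_darcais (p * Suc m + r) - int_darcais p ^ Suc m * int_darcais r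
    = (int_darcais (p + (p * m + r)) - int_darcais p * int_darcais (p * m + r))
    + int_darcais p * (int_darcais (p * m + r) - int_darcais p ^ m * int_darcais r)"
    by (simp add: algebra_simps)
  then show ?case
    using dvd_add [OF int_darcais_add dvd_mult [OF Suc]] by simp
qed simp

section \<open>Norms of values at Gaussian integers\<close>

text \<open>Real and imaginary part of \<open>q(a\<i> + b)\<close>, by Horner's rule.\<close>

definition gauss_eval :: "int \<Rightarrow> int \<Rightarrow> int poly \<Rightarrow> int \<times> int" where
  "gauss_eval a b q = fold_coeffs (\<lambda>c (u, v). (c + b * u - a * v, b * v + a * u)) q (0, 0)"

text \<open>The norm from the Gaussian integers turns divisibility of values there into divisibility
  in the integers.\<close>

definition gauss_norm :: "int \<Rightarrow> int \<Rightarrow> int poly \<Rightarrow> int" where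
  "gauss_norm a b q = (case gauss_eval a b q of (u, v) \<Rightarrow> u ^ 2 + v ^ 2)"

lemma gauss_eval_0: "gauss_eval a b 0 = (0, 0)"
  by (simp add: gauss_eval_def)

lemma gauss_eval_pCons:
  "gauss_eval a b (pCons c q) =
    (case gauss_eval a b q of (u, v) \<Rightarrow> (c + b * u - a * v, b * v + a * u))"
  by (cases "q = 0 \<and> c = 0") (auto simp: gauss_eval_def)

lemma poly_eq_gauss_eval:
  "poly (map_poly of_int q) (of_int a * \<i> + of_int b) =
    Complex (of_int (fst (gauss_eval a b q))) (of_int (snd (gauss_eval a b q)))"
  by (induction q)
    (auto simp: gauss_eval_0 gauss_eval_pCons map_poly_pCons complex_eq_iff algebra_simps
      split: prod.splits)

lemma gauss_norm_eq_cmod: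
  "of_int (gauss_norm a b q) =
    (cmod (poly (map_poly of_int q) (of_int a * \<i> + of_int b))) ^ 2"
  by (simp add: poly_eq_gauss_eval gauss_norm_def cmod_power2 split: prod.splits)

text \<open>Inherited from the multiplicativity of the complex modulus, which avoids expanding
  Horner's rule.\<close>

lemma gauss_norm_mult: "gauss_norm a b (f * g) = gauss_norm a b f * gauss_norm a b g"
proof -
  have "real_of_int (gauss_norm a b (f * g)) = of_int (gauss_norm a b f * gauss_norm a b g)"
    by (simp only: of_int_mult gauss_norm_eq_cmod map_poly_of_int_mult poly_mult norm_mult
        power_mult_distrib)
  then show ?thesis by linarith
qed

lemma gauss_norm_power: "gauss_norm a b (f ^ m) = gauss_norm a b f ^ m"
  by (induction m)
    (simp_all add: gauss_norm_mult,
      simp add: gauss_norm_def gauss_eval_0 gauss_eval_pCons one_pCons)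

text \<open>If \<open>f = g + p h\<close>, the values of \<open>f\<close> and \<open>g\<close>
  differ by \<open>p\<close> times the Gaussian integer \<open>h(z)\<close>, so real and imaginary
  parts are congruent separately.\<close>

lemma gauss_norm_cong_poly:
  assumes "[:p:] dvd f - g"
  shows "[gauss_norm a b f = gauss_norm a b g] (mod p)"
proof -
  obtain h where "f - g = [:p:] * h" using assms by (elim dvdE)
  then have f: "f = g + [:p:] * h" by (simp add: algebra_simps)
  define z where "z = of_int a * \<i> + of_int b"
  have "poly (map_poly of_int f) z
      = poly (map_poly of_int g) z + of_int p * poly (map_poly of_int h) z"
    by (simp add: f map_poly_of_int_add map_poly_smult)
  then have "fst (gauss_eval a b f) = fst (gauss_eval a b g) + p * fst (gauss_eval a b h)
     \<and> snd (gauss_eval a b f) = snd (gauss_eval a b g) + p * snd (gauss_eval a b h)"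
    unfolding z_def poly_eq_gauss_eval complex_eq_iff
    by (simp flip: of_int_mult of_int_add)
  then have "[fst (gauss_eval a b f) = fst (gauss_eval a b g)] (mod p)"
    "[snd (gauss_eval a b f) = snd (gauss_eval a b g)] (mod p)"
    by (simp_all add: cong_def)
  then show ?thesis
    unfolding gauss_norm_def by (auto intro!: cong_add cong_pow split: prod.splits)
qed

text \<open>Horner's rule uses only ring operations. This reduces the nonvanishing to finitely many
  pairs of residues.\<close>

lemma gauss_norm_mod: "[gauss_norm (a mod p) (b mod p) q = gauss_norm a b q] (mod p)"
proof -
  have *: "[a mod p = a] (mod p)" "[b mod p = b] (mod p)" by (simp_all add: cong_def)
  have "[fst (gauss_eval (a mod p) (b mod p) q) = fst (gauss_eval a b q)] (mod p) \<and>
    [snd (gauss_eval (a mod p) (b mod p) q) = snd (gauss_eval a b q)] (mod p)"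
    by (induction q)
      (auto simp: gauss_eval_0 gauss_eval_pCons split: prod.splits
        intro!: cong_add cong_diff cong_mult * cong_refl)
  then show ?thesis
    unfolding gauss_norm_def by (auto intro!: cong_add cong_pow split: prod.splits)
qed

lemma poly_darcais_eq_0_imp_dvd_gauss_norm:
  assumes "prime p"
    and "poly (map_poly of_rat (darcais n)) (of_int a * \<i> + of_int b :: complex) = 0"
  shows "int p dvd gauss_norm (a mod int p) (b mod int p) (int_darcais p) \<or>
    int p dvd gauss_norm (a mod int p) (b mod int p) (int_darcais (n mod p))"
proof -
  \<comment> \<open>Passing through the rationals makes \<open>int_darcais_eq\<close> applicable, so
    a zero of \<open>darcais n\<close> is a zero of \<open>int_darcais n\<close>.\<close>
  have "map_poly of_int (int_darcais n)
      = (map_poly of_rat (map_poly of_int (int_darcais n)) :: complex poly)"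
    by (rule poly_eqI) (simp add: coeff_map_poly)
  also have "\<dots> = smult (fact n) (map_poly of_rat (darcais n))"
  proof (rule poly_eqI)
    have "of_rat (fact n) = (fact n :: complex)"
      by (metis of_nat_fact of_rat_of_nat_eq)
    then show "coeff (map_poly of_rat (map_poly of_int (int_darcais n))) i
      = coeff (smult (fact n) (map_poly of_rat (darcais n)) :: complex poly) i" for i
      by (simp add: int_darcais_eq coeff_map_poly of_rat_mult)
  qed
  finally have "gauss_norm a b (int_darcais n) = 0"
    using assms(2) gauss_norm_eq_cmod [of a b "int_darcais n"] by simp
  moreover have "[:int p:] dvd
      int_darcais n - int_darcais p ^ (n div p) * int_darcais (n mod p)"
    using int_darcais_mult_add [of p "n div p" "n mod p"] by simp
  ultimately have
    "int p dvd gauss_norm a b (int_darcais p) ^ (n div p) * gauss_norm a b (int_darcais (n mod p))"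
    using gauss_norm_cong_poly [of "int p" _ _ a b]
    by (metis cong_0_iff cong_sym gauss_norm_mult gauss_norm_power)
  then have "int p dvd gauss_norm a b (int_darcais p) \<or>
      int p dvd gauss_norm a b (int_darcais (n mod p))"
    using assms(1) by (metis prime_dvd_mult_iff prime_dvd_power prime_nat_int_transfer)
  then show ?thesis
    using cong_dvd_iff [OF gauss_norm_mod [of a "int p" b]] by blast
qed

section \<open>Explicit values and residue checks\<close>

text \<open>A form that can be evaluated, unlike the set comprehension in the definition.\<close>

lemma divisor_sigma_eq:
  assumes "n > 0"
  shows "divisor_sigma n = sum_list (filter (\<lambda>d. d dvd n) [1..<Suc n])"
proof -
  have "{d. d dvd n} = set (filter (\<lambda>d. d dvd n) [1..<Suc n])"
    using assms by (auto dest: dvd_imp_le simp: Suc_le_eq dvd_pos_nat)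
  then show ?thesis
    unfolding divisor_sigma_def by (simp only: sum_code distinct_filter distinct_upt
        distinct_remdups_id list.map_ident)
qed

lemma divisor_sigma_values:
  "divisor_sigma (Suc 0) = 1" "divisor_sigma 2 = 3" "divisor_sigma 3 = 4"
  "divisor_sigma 4 = 7" "divisor_sigma 5 = 6" "divisor_sigma 6 = 12" "divisor_sigma 7 = 8"
  by (subst divisor_sigma_eq, simp, code_simp)+

lemmas int_darcais_recurrence_simps =
  divisor_sigma_values lessThan_nat_numeral atLeastLessThan_nat_numeral

lemma int_darcais_0: "int_darcais 0 = 1"
  by (simp add: int_darcais.simps)

lemma int_darcais_1: "int_darcais (Suc 0) = [:0, 1:]"
  by (subst int_darcais.simps)
    (simp add: int_darcais_0 int_darcais_recurrence_simps)

lemma int_darcais_2: "int_darcais 2 = [:0, 3, 1:]"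
  by (subst int_darcais.simps)
    (simp add: int_darcais_0 int_darcais_1 int_darcais_recurrence_simps)

lemma int_darcais_3: "int_darcais 3 = [:0, 8, 9, 1:]"
  by (subst int_darcais.simps)
    (simp add: int_darcais_0 int_darcais_1 int_darcais_2 int_darcais_recurrence_simps)

lemma int_darcais_4: "int_darcais 4 = [:0, 42, 59, 18, 1:]"
  by (subst int_darcais.simps)
    (simp add: int_darcais_0 int_darcais_1 int_darcais_2 int_darcais_3 int_darcais_recurrence_simps)

lemma int_darcais_5: "int_darcais 5 = [:0, 144, 450, 215, 30, 1:]"
  by (subst int_darcais.simps)
    (simp add: int_darcais_0 int_darcais_1 int_darcais_2 int_darcais_3 int_darcais_4
      int_darcais_recurrence_simps)

lemma int_darcais_6: "int_darcais 6 = [:0, 1440, 3394, 2475, 565, 45, 1:]"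
  by (subst int_darcais.simps)
    (simp add: int_darcais_0 int_darcais_1 int_darcais_2 int_darcais_3 int_darcais_4
      int_darcais_5 int_darcais_recurrence_simps)

lemma int_darcais_7: "int_darcais 7 = [:0, 5760, 30912, 28294, 9345, 1225, 63, 1:]"
  by (subst int_darcais.simps)
    (simp add: int_darcais_0 int_darcais_1 int_darcais_2 int_darcais_3 int_darcais_4
      int_darcais_5 int_darcais_6 int_darcais_recurrence_simps)

lemmas int_darcais_values = int_darcais_0 int_darcais_1 int_darcais_2 int_darcais_3
  int_darcais_4 int_darcais_5 int_darcais_6 int_darcais_7

text \<open>The index \<open>3\<close> joins the remainders because \<open>int_darcais p\<close> has
  to be checked too. Modulo \<open>3\<close> it is \<open>X^3 - X\<close>, whose zeros in the field
  of \<open>9\<close> elements lie in the prime field, that is, at \<open>x = 0\<close>.\<close>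

lemma gauss_norm_int_darcais_not_dvd_3:
  assumes "r \<in> {0, Suc 0, 2, 3}"
  shows "\<forall>x\<in>{1, 2}. \<forall>y\<in>{0, 1, 2}. \<not> 3 dvd gauss_norm x y (int_darcais r)"
  using assms by (elim insertE emptyE; simp only: int_darcais_values; code_simp)

text \<open>Modulo \<open>7\<close>, \<open>int_darcais 7\<close> is \<open>X^7 - X\<close>, and
  \<open>int_darcais 5\<close> is \<open>X (X^2 + 1) (X^2 + 2 X + 4)\<close>. The last factor splits
  over the prime field, so the only exceptions with \<open>x\<close> nonzero are the square roots of
  \<open>-1\<close>, at \<open>x = 1\<close> or \<open>6\<close> and \<open>y = 0\<close>.\<close>

lemma gauss_norm_int_darcais_not_dvd_7:
  assumes "r \<in> {0, Suc 0, 2, 3, 4, 5, 6, 7}"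
  shows "\<forall>x\<in>{1, 2, 3, 4, 5, 6}. \<forall>y\<in>{0, 1, 2, 3, 4, 5, 6}.
    r \<noteq> 5 \<or> x \<notin> {1, 6} \<or> y \<noteq> 0 \<longrightarrow> \<not> 7 dvd gauss_norm x y (int_darcais r)"
  using assms by (elim insertE emptyE; simp only: int_darcais_values; code_simp)

lemma poly_darcais_neq_0_mod_3:
  assumes "\<not> 3 dvd a"
  shows "poly (map_poly of_rat (darcais n)) (of_int a * \<i> + of_int b :: complex) \<noteq> 0"
proof -
  have "a mod 3 \<in> {1, 2}" using assms by simp presburger
  moreover have "b mod 3 \<in> {0, 1, 2}" by simp presburger
  moreover have "n mod 3 \<in> {0, Suc 0, 2, 3}" by simp presburger
  ultimately show ?thesis
    using poly_darcais_eq_0_imp_dvd_gauss_norm [of 3 n a b]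
      gauss_norm_int_darcais_not_dvd_3 [of 3] gauss_norm_int_darcais_not_dvd_3 [of "n mod 3"]
    by auto
qed

lemma poly_darcais_neq_0_mod_7:
  assumes "\<not> 7 dvd a" and "n mod 7 \<noteq> 5 \<or> a mod 7 \<notin> {1, 6} \<or> \<not> 7 dvd b"
  shows "poly (map_poly of_rat (darcais n)) (of_int a * \<i> + of_int b :: complex) \<noteq> 0"
proof -
  have a: "a mod 7 \<in> {1, 2, 3, 4, 5, 6}" using assms(1) by simp presburger
  have b: "b mod 7 \<in> {0, 1, 2, 3, 4, 5, 6}" by simp presburger
  have n: "n mod 7 \<in> {0, Suc 0, 2, 3, 4, 5, 6, 7}" by simp presburger
  note not_dvd = gauss_norm_int_darcais_not_dvd_7 [THEN bspec, OF _ a, THEN bspec, OF _ b, THEN mp]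
  have "\<not> 7 dvd gauss_norm (a mod 7) (b mod 7) (int_darcais 7)"
    by (rule not_dvd) simp_all
  moreover have "\<not> 7 dvd gauss_norm (a mod 7) (b mod 7) (int_darcais (n mod 7))"
    using assms(2) by (intro not_dvd n) (simp add: dvd_eq_mod_eq_0)
  moreover have "prime (7 :: nat)" by simp
  ultimately show ?thesis
    using poly_darcais_eq_0_imp_dvd_gauss_norm [of 7 n a b] by auto
qed

theorem theorem4:
  fixes a b :: int and n :: nat
  shows "(\<not> [n = 5] (mod 7) \<and> \<not> 21 dvd a \<longrightarrow>
            poly (map_poly of_rat (darcais n)) (of_int a * \<i> + of_int b :: complex) \<noteq> 0) \<and>
         ([n = 5] (mod 7) \<and>
            (\<not> 3 dvd a \<or>
             \<not> ([a = 0] (mod 7) \<or> [a = 1] (mod 7) \<or> [a = -1] (mod 7)) \<or>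
             (\<not> 7 dvd a \<and> \<not> 7 dvd b)) \<longrightarrow>
            poly (map_poly of_rat (darcais n)) (of_int a * \<i> + of_int b :: complex) \<noteq> 0)"
proof -
  \<comment> \<open>If \<open>21\<close> does not divide \<open>a\<close>, then \<open>3\<close> or
    \<open>7\<close> does not, and the check modulo that prime applies.\<close>
  have "(21 :: int) dvd a" if "3 dvd a" "7 dvd a"
    using that by presburger
  moreover have "[a = 1] (mod 7) \<longleftrightarrow> a mod 7 = 1" "[a = -1] (mod 7) \<longleftrightarrow> a mod 7 = 6"
    "[a = 0] (mod 7) \<longleftrightarrow> 7 dvd a" "[n = 5] (mod 7) \<longleftrightarrow> n mod 7 = 5"
    by (simp_all add: cong_def dvd_eq_mod_eq_0)
  ultimately show ?thesis
    using poly_darcais_neq_0_mod_3 [of a n b] poly_darcais_neq_0_mod_7 [of a n b] by auto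
qed

end
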